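(* Let $n \geq 1$ be an integer and let $A \subseteq \mathbb{F}_3^n$ be a cap set. Then, for every integer $r \geq 1$, there is a cap set $B \subseteq \mathbb{F}_3^{2nr}$ of size \[|B| = r|A|^{2r-2}.\]
   Context: $\mathbb{F}_3$ is the field with three elements. A cap set in $\mathbb{F}_3^N$ is a set $S \subseteq \mathbb{F}_3^N$ with no solutions to $x+y+z=0$ with $x,y,z\in S$, other than the trivial solutions $x=y=z$. *)

theory Defs
  imports "Jordan_Normal_Form.Matrix"
begin

text \<open>The three-element type of theory \<open>HOL.Enum\<close> is an instance of class \<^class>\<open>field\<close>,
  hence a model of the field with three elements. The space of vectors of length
  \<open>N\<close> over it is \<open>carrier_vec N :: F3 vec set\<close>.\<close>

type_synonym F3 = Enum.finite_3

lemma card_F3: "card (UNIV :: F3 set) = 3"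
  by (simp add: UNIV_finite_3)

definition cap_set :: "nat \<Rightarrow> F3 vec set \<Rightarrow> bool" where
  "cap_set N S \<longleftrightarrow> S \<subseteq> carrier_vec N \<and>
     (\<forall>x\<in>S. \<forall>y\<in>S. \<forall>z\<in>S. x + y + z = 0\<^sub>v N \<longrightarrow> x = y \<and> y = z)"

end

theory Submission
  imports Defs
begin

text \<open>Let \<open>c = card A\<close>. A translate of the cap set \<open>A\<close> avoids \<open>0\<close>, because \<open>A\<close> is not the
  whole space. For a cap set \<open>A\<close> avoiding \<open>0\<close>, let \<open>D\<^sub>1\<close> be the set of all \<open>(x, y)\<close> and
  \<open>D\<^sub>2\<close> the set of all \<open>(x + y, x - y)\<close>, where \<open>x\<close> and \<open>y\<close> range over \<open>A\<close>. Both
  are cap sets of size \<open>c\<^sup>2\<close> of vectors of length \<open>2n\<close> and avoid \<open>0\<close>, the second one since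
  \<open>(x, y) \<mapsto> (x + y, x - y)\<close> is invertible in characteristic \<open>3\<close>. Moreover, \<open>d + e \<noteq> 0\<close> for
  all \<open>d\<close> in \<open>D\<^sub>1\<close> and \<open>e\<close> in \<open>D\<^sub>2\<close>: if \<open>(a, b) + (x + y, x - y) = 0\<close> with \<open>a, b, x, y\<close> in
  \<open>A\<close>, then \<open>a + x + y = 0\<close> forces \<open>x = y\<close>, hence \<open>b = 0\<close>, which is excluded
  (\<open>product_rotated_product_nonzero\<close>).

  The set \<open>B\<close> consists of the vectors made of \<open>r\<close> blocks of length \<open>2n\<close>, exactly one of which,
  the pivot, is \<open>0\<close>, while the blocks before it lie in \<open>D\<^sub>1\<close> and those after it in \<open>D\<^sub>2\<close>. There
  are \<open>r\<close> choices of the pivot and \<open>c\<^sup>2\<close> of each other block. If three elements of \<open>B\<close> sum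
  to \<open>0\<close> and share their pivot, they agree blockwise because \<open>D\<^sub>1\<close> and \<open>D\<^sub>2\<close> are cap sets.
  Otherwise, let \<open>k\<close> be the median of their pivots. The blocks at position \<open>k\<close> are either
  \<open>0, 0\<close> and a nonzero block, or \<open>0\<close>, an element of \<open>D\<^sub>1\<close> and an element of \<open>D\<^sub>2\<close>; neither sums
  to \<open>0\<close> (\<open>cap_set_staircase\<close>).\<close>

section \<open>Cap sets over the field with three elements\<close>

lemma F3_triple: "(a::F3) + a + a = 0"
  by (cases a) (simp_all add: zero_finite_3_def plus_finite_3_def)

lemma F3_rotation:
  fixes x y :: F3
  assumes "x + y = 0" and "x - y = 0"
  shows "x = 0" and "y = 0"
  using assms
  by (cases x; cases y; simp add: zero_finite_3_def plus_finite_3_def minus_finite_3_def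
      uminus_finite_3_def)+

lemma vec_F3_triple:
  fixes v :: "F3 vec"
  assumes "v \<in> carrier_vec n"
  shows "v + v + v = 0\<^sub>v n"
proof (rule eq_vecI)
  fix i assume "i < dim_vec (0\<^sub>v n :: F3 vec)"
  then have i: "i < n" by simp
  with assms have "(v + v + v) $ i = v $ i + v $ i + v $ i" by (simp add: add.assoc)
  also have "\<dots> = 0" by (rule F3_triple)
  finally show "(v + v + v) $ i = 0\<^sub>v n $ i" using i by simp
qed (use assms in simp)

lemma finite_carrier_vec_F3: "finite (carrier_vec n :: F3 vec set)"
proof -
  have "(carrier_vec n :: F3 vec set) \<subseteq> vec_of_list ` {xs. set xs \<subseteq> UNIV \<and> length xs = n}"
  proof
    fix v :: "F3 vec" assume "v \<in> carrier_vec n"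
    then have "v = vec_of_list (list_of_vec v)" "length (list_of_vec v) = n"
      by (simp_all add: vec_list)
    then show "v \<in> vec_of_list ` {xs. set xs \<subseteq> UNIV \<and> length xs = n}" by blast
  qed
  moreover have "finite {xs. set xs \<subseteq> (UNIV :: F3 set) \<and> length xs = n}"
    by (rule finite_lists_length_eq) simp
  ultimately show ?thesis by (meson finite_imageI finite_subset)
qed

lemma cap_set_carrier: "cap_set n S \<Longrightarrow> x \<in> S \<Longrightarrow> x \<in> carrier_vec n"
  by (auto simp: cap_set_def)

lemma cap_setD:
  assumes "cap_set n S" "x \<in> S" "y \<in> S" "z \<in> S" "x + y + z = 0\<^sub>v n"
  shows "x = y" and "y = z"
  using assms unfolding cap_set_def by blast+

lemma cap_set_misses_vector:
  assumes "n \<ge> 1" and "cap_set n A"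
  obtains t where "t \<in> carrier_vec n" and "t \<notin> A"
proof -
  \<comment> \<open>The distinct vectors \<open>0, 1, -1\<close> sum to \<open>0\<close>.\<close>
  define u :: "F3 vec" where "u = vec n (\<lambda>_. 1)"
  have u: "u \<in> carrier_vec n" "- u \<in> carrier_vec n" by (auto simp: u_def)
  have "0\<^sub>v n + u + (- u) = 0\<^sub>v n" using u by auto
  moreover have "0\<^sub>v n $ 0 \<noteq> u $ 0" using assms(1) by (simp add: u_def)
  then have "0\<^sub>v n \<noteq> u" by metis
  ultimately have "\<not> (0\<^sub>v n \<in> A \<and> u \<in> A \<and> - u \<in> A)"
    using cap_setD(1)[OF assms(2)] by blast
  with u that show thesis by (metis zero_carrier_vec)
qed

lemma cap_set_translate:
  assumes A: "cap_set n A" and t: "t \<in> carrier_vec n"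
  shows "cap_set n ((\<lambda>x. x - t) ` A)" and "card ((\<lambda>x. x - t) ` A) = card A"
proof -
  have carr: "x \<in> carrier_vec n" if "x \<in> A" for x
    using that A by (rule cap_set_carrier[rotated])
  show "cap_set n ((\<lambda>x. x - t) ` A)"
    unfolding cap_set_def
  proof (intro conjI ballI impI)
    show "(\<lambda>x. x - t) ` A \<subseteq> carrier_vec n" using carr t by auto
  next
    fix x' y' z' assume "x' \<in> (\<lambda>x. x - t) ` A" "y' \<in> (\<lambda>x. x - t) ` A" "z' \<in> (\<lambda>x. x - t) ` A"
      and sum: "x' + y' + z' = 0\<^sub>v n"
    then obtain x y z where xyz: "x \<in> A" "y \<in> A" "z \<in> A"
      and eqs: "x' = x - t" "y' = y - t" "z' = z - t" by blast
    \<comment> \<open>In characteristic \<open>3\<close>, translating three vectors does not change their sum.\<close>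
    have "x + y + z = (x' + y' + z') + (t + t + t)"
      using carr[OF xyz(1)] carr[OF xyz(2)] carr[OF xyz(3)] t
      unfolding eqs by (intro eq_vecI) (auto simp: algebra_simps)
    also have "\<dots> = 0\<^sub>v n" unfolding sum vec_F3_triple[OF t] by simp
    finally have "x + y + z = 0\<^sub>v n" .
    from cap_setD[OF A xyz this] eqs show "x' = y'" "y' = z'" by simp_all
  qed
  have "inj_on (\<lambda>x. x - t) A"
  proof (rule inj_onI)
    fix x y assume "x \<in> A" "y \<in> A" and eq: "x - t = y - t"
    then have "x \<in> carrier_vec n" "y \<in> carrier_vec n" using carr by auto
    then have "x = (x - t) + t" "(y - t) + t = y" using t by auto
    with eq show "x = y" by simp
  qed
  then show "card ((\<lambda>x. x - t) ` A) = card A" by (rule card_image)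
qed

section \<open>Two square products of a cap set\<close>

text \<open>The cap set \<open>D\<^sub>1 = A \<times> A\<close>, with pairs encoded by concatenation.\<close>

definition product_cap :: "F3 vec set \<Rightarrow> F3 vec set" where
  "product_cap A = (\<lambda>(x, y). x @\<^sub>v y) ` (A \<times> A)"

text \<open>The cap set \<open>D\<^sub>2\<close>, the image of \<open>A \<times> A\<close> under \<open>(x, y) \<mapsto> (x + y, x - y)\<close>.\<close>

definition rotated_product_cap :: "F3 vec set \<Rightarrow> F3 vec set" where
  "rotated_product_cap A = (\<lambda>(x, y). (x + y) @\<^sub>v (x - y)) ` (A \<times> A)"

lemma append_vec_eq_0:
  assumes "x \<in> carrier_vec n" and "y \<in> carrier_vec m"
  shows "x @\<^sub>v y = 0\<^sub>v (n + m) \<longleftrightarrow> x = 0\<^sub>v n \<and> y = 0\<^sub>v m"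
proof -
  have "0\<^sub>v (n + m) = 0\<^sub>v n @\<^sub>v 0\<^sub>v m" by (intro eq_vecI) auto
  then show ?thesis using append_vec_eq[OF assms(1) zero_carrier_vec] by metis
qed

lemma vec_rotation_eq_0:
  fixes x y :: "F3 vec"
  assumes "x \<in> carrier_vec n" "y \<in> carrier_vec n" "x + y = 0\<^sub>v n" "x - y = 0\<^sub>v n"
  shows "x = 0\<^sub>v n" and "y = 0\<^sub>v n"
proof -
  have "x $ i = 0 \<and> y $ i = 0" if "i < n" for i
  proof -
    have "x $ i + y $ i = 0" "x $ i - y $ i = 0"
      using assms(1,2) that arg_cong[OF assms(3), of "\<lambda>v. v $ i"]
        arg_cong[OF assms(4), of "\<lambda>v. v $ i"]
      by auto
    from F3_rotation[OF this] show ?thesis by blast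
  qed
  then show "x = 0\<^sub>v n" "y = 0\<^sub>v n" using assms(1,2) by (auto intro!: eq_vecI)
qed

lemma cap_set_product:
  assumes A: "cap_set n A"
  shows "cap_set (n + n) (product_cap A)"
  unfolding cap_set_def
proof (intro conjI ballI impI)
  have carr: "x \<in> carrier_vec n" if "x \<in> A" for x
    using that A by (rule cap_set_carrier[rotated])
  show "product_cap A \<subseteq> carrier_vec (n + n)" using carr by (auto simp: product_cap_def)
  fix p q s assume "p \<in> product_cap A" "q \<in> product_cap A" "s \<in> product_cap A"
    and sum: "p + q + s = 0\<^sub>v (n + n)"
  then obtain x1 y1 x2 y2 x3 y3 where
    mem: "x1 \<in> A" "y1 \<in> A" "x2 \<in> A" "y2 \<in> A" "x3 \<in> A" "y3 \<in> A"
    and eqs: "p = x1 @\<^sub>v y1" "q = x2 @\<^sub>v y2" "s = x3 @\<^sub>v y3"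
    by (auto simp: product_cap_def)
  note c = mem[THEN carr]
  have "p + q + s = (x1 + x2 + x3) @\<^sub>v (y1 + y2 + y3)"
    unfolding eqs using c by (intro eq_vecI) auto
  then have "x1 + x2 + x3 = 0\<^sub>v n" "y1 + y2 + y3 = 0\<^sub>v n"
    using sum c append_vec_eq_0[of "x1 + x2 + x3" n "y1 + y2 + y3" n] by auto
  then have "x1 = x2" "x2 = x3" "y1 = y2" "y2 = y3"
    using cap_setD[OF A mem(1,3,5)] cap_setD[OF A mem(2,4,6)] by simp_all
  then show "p = q" "q = s" by (simp_all add: eqs)
qed

lemma cap_set_rotated_product:
  assumes A: "cap_set n A"
  shows "cap_set (n + n) (rotated_product_cap A)"
  unfolding cap_set_def
proof (intro conjI ballI impI)
  have carr: "x \<in> carrier_vec n" if "x \<in> A" for x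
    using that A by (rule cap_set_carrier[rotated])
  show "rotated_product_cap A \<subseteq> carrier_vec (n + n)"
    using carr by (auto simp: rotated_product_cap_def)
  fix p q s
  assume "p \<in> rotated_product_cap A" "q \<in> rotated_product_cap A" "s \<in> rotated_product_cap A"
    and sum: "p + q + s = 0\<^sub>v (n + n)"
  then obtain x1 y1 x2 y2 x3 y3 where
    mem: "x1 \<in> A" "y1 \<in> A" "x2 \<in> A" "y2 \<in> A" "x3 \<in> A" "y3 \<in> A"
    and eqs: "p = (x1 + y1) @\<^sub>v (x1 - y1)" "q = (x2 + y2) @\<^sub>v (x2 - y2)"
      "s = (x3 + y3) @\<^sub>v (x3 - y3)"
    by (auto simp: rotated_product_cap_def)
  note c = mem[THEN carr]
  define X Y where "X = x1 + x2 + x3" and "Y = y1 + y2 + y3"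
  have XY: "X \<in> carrier_vec n" "Y \<in> carrier_vec n" using c by (auto simp: X_def Y_def)
  have "p + q + s = (X + Y) @\<^sub>v (X - Y)"
    unfolding eqs X_def Y_def using c by (intro eq_vecI) (auto simp: algebra_simps)
  then have "X + Y = 0\<^sub>v n" "X - Y = 0\<^sub>v n"
    using sum XY append_vec_eq_0[of "X + Y" n "X - Y" n] by auto
  from vec_rotation_eq_0[OF XY this] have "x1 + x2 + x3 = 0\<^sub>v n" "y1 + y2 + y3 = 0\<^sub>v n"
    by (simp_all add: X_def Y_def)
  then have "x1 = x2" "x2 = x3" "y1 = y2" "y2 = y3"
    using cap_setD[OF A mem(1,3,5)] cap_setD[OF A mem(2,4,6)] by simp_all
  then show "p = q" "q = s" by (simp_all add: eqs)
qed

lemma card_product_cap: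
  assumes "A \<subseteq> carrier_vec n"
  shows "card (product_cap A) = card A ^ 2"
proof -
  have "inj_on (\<lambda>(x, y). x @\<^sub>v y) (A \<times> A)"
    using assms by (auto simp: inj_on_def append_vec_eq[of _ n] subset_iff)
  then show ?thesis
    by (simp add: product_cap_def card_image card_cartesian_product power2_eq_square)
qed

lemma card_rotated_product_cap:
  fixes A :: "F3 vec set"
  assumes A: "A \<subseteq> carrier_vec n"
  shows "card (rotated_product_cap A) = card A ^ 2"
proof -
  have "inj_on (\<lambda>(x, y). (x + y) @\<^sub>v (x - y)) (A \<times> A)"
  proof (rule inj_onI, clarify)
    fix x y x' y' assume mem: "x \<in> A" "y \<in> A" "x' \<in> A" "y' \<in> A"
      and eq: "(x + y) @\<^sub>v (x - y) = (x' + y') @\<^sub>v (x' - y')"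
    have c: "x \<in> carrier_vec n" "y \<in> carrier_vec n" "x' \<in> carrier_vec n" "y' \<in> carrier_vec n"
      using A mem by auto
    have eqs: "x + y = x' + y'" "x - y = x' - y'"
      using eq append_vec_eq[of "x + y" n "x' + y'" "x - y" "x' - y'"] c by auto
    have coord: "x $ i = x' $ i \<and> y $ i = y' $ i" if "i < n" for i
    proof -
      have "x $ i + y $ i = x' $ i + y' $ i" "x $ i - y $ i = x' $ i - y' $ i"
        using arg_cong[OF eqs(1), of "\<lambda>v. v $ i"] arg_cong[OF eqs(2), of "\<lambda>v. v $ i"] c that
        by auto
      then have "(x $ i - x' $ i) + (y $ i - y' $ i) = 0" "(x $ i - x' $ i) - (y $ i - y' $ i) = 0"
        by (simp_all add: algebra_simps)
      from F3_rotation[OF this] show ?thesis by (simp only: right_minus_eq)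
    qed
    show "x = x' \<and> y = y'" using c coord by (auto intro!: eq_vecI)
  qed
  then show ?thesis
    by (simp add: rotated_product_cap_def card_image card_cartesian_product power2_eq_square)
qed

lemma zero_notin_product_cap:
  assumes "A \<subseteq> carrier_vec n" and "0\<^sub>v n \<notin> A"
  shows "0\<^sub>v (n + n) \<notin> product_cap A"
proof
  assume "0\<^sub>v (n + n) \<in> product_cap A"
  then obtain x y where "x \<in> A" "y \<in> A" "x @\<^sub>v y = 0\<^sub>v (n + n)" by (auto simp: product_cap_def)
  with assms append_vec_eq_0[of x n y n] show False by auto
qed

lemma zero_notin_rotated_product_cap:
  assumes "A \<subseteq> carrier_vec n" and "0\<^sub>v n \<notin> A"
  shows "0\<^sub>v (n + n) \<notin> rotated_product_cap A"
proof
  assume "0\<^sub>v (n + n) \<in> rotated_product_cap A"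
  then obtain x y where xy: "x \<in> A" "y \<in> A" "(x + y) @\<^sub>v (x - y) = 0\<^sub>v (n + n)"
    by (auto simp: rotated_product_cap_def)
  then have "x \<in> carrier_vec n" "y \<in> carrier_vec n" using assms(1) by auto
  with xy append_vec_eq_0[of "x + y" n "x - y" n] vec_rotation_eq_0(1)[of x n y]
  have "x = 0\<^sub>v n" by auto
  with xy assms(2) show False by simp
qed

lemma product_rotated_product_nonzero:
  assumes A: "cap_set n A" and "0\<^sub>v n \<notin> A"
    and "d \<in> product_cap A" and "e \<in> rotated_product_cap A"
  shows "d + e \<noteq> 0\<^sub>v (n + n)"
proof
  assume sum: "d + e = 0\<^sub>v (n + n)"
  obtain a b x y where mem: "a \<in> A" "b \<in> A" "x \<in> A" "y \<in> A"
    and eqs: "d = a @\<^sub>v b" "e = (x + y) @\<^sub>v (x - y)"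
    using assms(3,4) by (auto simp: product_cap_def rotated_product_cap_def)
  have c: "a \<in> carrier_vec n" "b \<in> carrier_vec n" "x \<in> carrier_vec n" "y \<in> carrier_vec n"
    using mem A by (auto intro: cap_set_carrier)
  have "d + e = (a + x + y) @\<^sub>v (b + (x - y))"
    unfolding eqs using c by (intro eq_vecI) (auto simp: algebra_simps)
  then have sums: "a + x + y = 0\<^sub>v n" "b + (x - y) = 0\<^sub>v n"
    using sum c append_vec_eq_0[of "a + x + y" n "b + (x - y)" n] by auto
  have "x = y" using cap_setD(2)[OF A _ _ _ sums(1)] mem by simp
  with sums(2) c have "b = 0\<^sub>v n" by simp
  with mem assms(2) show False by simp
qed

section \<open>Block vectors with an ordered pivot\<close>

text \<open>The vector of length \<open>m * r\<close> with blocks \<open>f 0, \<dots>, f (r - 1)\<close> of length \<open>m\<close>.\<close>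

definition concat_blocks :: "nat \<Rightarrow> nat \<Rightarrow> (nat \<Rightarrow> 'a vec) \<Rightarrow> 'a vec" where
  "concat_blocks m r f = vec (m * r) (\<lambda>i. f (i div m) $ (i mod m))"

lemma concat_blocks_nth:
  assumes "j < r" and "i < m"
  shows "concat_blocks m r f $ (j * m + i) = f j $ i"
proof -
  have "j * m + i < Suc j * m" using assms by simp
  also have "\<dots> \<le> m * r" using assms by (metis Suc_leI mult.commute mult_le_mono2)
  finally have "j * m + i < m * r" .
  with assms show ?thesis by (simp add: concat_blocks_def)
qed

lemma inj_on_concat_blocks: "inj_on (concat_blocks m r) (PiE {..<r} (\<lambda>_. carrier_vec m))"
proof (rule inj_onI)
  fix f g :: "nat \<Rightarrow> 'a vec"
  assume fg: "f \<in> PiE {..<r} (\<lambda>_. carrier_vec m)" "g \<in> PiE {..<r} (\<lambda>_. carrier_vec m)"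
    and eq: "concat_blocks m r f = concat_blocks m r g"
  show "f = g"
  proof (rule PiE_ext[OF fg])
    fix j assume j: "j \<in> {..<r}"
    then have "f j \<in> carrier_vec m" "g j \<in> carrier_vec m" using fg by auto
    with j eq show "f j = g j"
      by (intro eq_vecI) (auto simp flip: concat_blocks_nth[of j r _ m])
  qed
qed

lemma concat_blocks_sum_0:
  fixes f g h :: "nat \<Rightarrow> F3 vec"
  assumes "f \<in> PiE {..<r} (\<lambda>_. carrier_vec m)" "g \<in> PiE {..<r} (\<lambda>_. carrier_vec m)"
    "h \<in> PiE {..<r} (\<lambda>_. carrier_vec m)"
    and sum: "concat_blocks m r f + concat_blocks m r g + concat_blocks m r h = 0\<^sub>v (m * r)"
    and j: "j < r"
  shows "f j + g j + h j = 0\<^sub>v m"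
proof -
  have c: "f j \<in> carrier_vec m" "g j \<in> carrier_vec m" "h j \<in> carrier_vec m"
    using assms(1-3) j by auto
  have "f j $ i + g j $ i + h j $ i = 0" if i: "i < m" for i
  proof -
    have "j * m + i < Suc j * m" using i by simp
    also have "\<dots> \<le> m * r" using j by (metis Suc_leI mult.commute mult_le_mono2)
    finally have lt: "j * m + i < m * r" .
    from arg_cong[OF sum, of "\<lambda>v. v $ (j * m + i)"] lt
    have "concat_blocks m r f $ (j * m + i) + concat_blocks m r g $ (j * m + i)
        + concat_blocks m r h $ (j * m + i) = 0"
      by (simp add: concat_blocks_def add.assoc)
    then show ?thesis using i j by (simp add: concat_blocks_nth)
  qed
  then show ?thesis using c by (intro eq_vecI) (auto simp: add.assoc)
qed

text \<open>The sequences of \<open>r\<close> blocks with pivot \<open>k\<close>: zero at position \<open>k\<close>, in \<open>D\<close> before it and in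
  \<open>E\<close> after it.\<close>

definition stair :: "nat \<Rightarrow> nat \<Rightarrow> 'a vec set \<Rightarrow> 'a vec set \<Rightarrow> nat \<Rightarrow> (nat \<Rightarrow> 'a :: zero vec) set" where
  "stair m r D E k = PiE {..<r} (\<lambda>j. if j < k then D else if j = k then {0\<^sub>v m} else E)"

text \<open>The vectors made of \<open>r\<close> such blocks, over all pivots \<open>k < r\<close>.\<close>

definition staircase :: "nat \<Rightarrow> nat \<Rightarrow> 'a vec set \<Rightarrow> 'a vec set \<Rightarrow> 'a :: zero vec set" where
  "staircase m r D E = concat_blocks m r ` (\<Union>k<r. stair m r D E k)"

lemma stair_PiE:
  assumes "D \<subseteq> carrier_vec m" "E \<subseteq> carrier_vec m" "f \<in> stair m r D E k"
  shows "f \<in> PiE {..<r} (\<lambda>_. carrier_vec m)"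
  using assms(3) unfolding stair_def
  by (rule subsetD[OF PiE_mono, rotated]) (use assms(1,2) in auto)

lemma stair_nth:
  assumes "f \<in> stair m r D E k" and "j < r"
  shows "j < k \<Longrightarrow> f j \<in> D" and "j = k \<Longrightarrow> f j = 0\<^sub>v m" and "k < j \<Longrightarrow> f j \<in> E"
  using PiE_mem[OF assms(1)[unfolded stair_def], of j] assms(2) by auto

lemma card_stair:
  assumes "card D = c" "card E = c" "k < r"
  shows "card (stair m r D E k) = c ^ (r - 1)"
proof -
  have "card (stair m r D E k)
      = (\<Prod>j<r. card (if j < k then D else if j = k then {0\<^sub>v m} else E))"
    unfolding stair_def by (rule card_PiE) simp
  also have "\<dots> = (\<Prod>j<r. if j = k then 1 else c)"
    using assms by (intro prod.cong) auto
  also have "\<dots> = (\<Prod>j\<in>{..<r} - {k}. c)"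
    using assms(3) by (subst prod.remove[of _ k]) (auto intro!: prod.cong)
  also have "\<dots> = c ^ (r - 1)" using assms(3) by simp
  finally show ?thesis .
qed

lemma stair_disjoint:
  assumes "0\<^sub>v m \<notin> D" "0\<^sub>v m \<notin> E" "k < r" "k \<noteq> l"
  shows "stair m r D E k \<inter> stair m r D E l = {}"
proof (rule equals0I)
  fix f assume "f \<in> stair m r D E k \<inter> stair m r D E l"
  then have "f k = 0\<^sub>v m" "f k \<in> D \<or> f k \<in> E"
    using stair_nth[of f m r D E _ k] assms(3,4) by (auto simp: neq_iff)
  with assms(1,2) show False by auto
qed

lemma card_staircase:
  assumes D: "D \<subseteq> carrier_vec m" "finite D" "card D = c" "0\<^sub>v m \<notin> D"
    and E: "E \<subseteq> carrier_vec m" "finite E" "card E = c" "0\<^sub>v m \<notin> E"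
  shows "card (staircase m r D E) = r * c ^ (r - 1)"
proof -
  have "inj_on (concat_blocks m r) (\<Union>k<r. stair m r D E k)"
    using stair_PiE[OF D(1) E(1)] by (intro inj_on_subset[OF inj_on_concat_blocks[of m r]]) blast
  then have "card (staircase m r D E) = card (\<Union>k<r. stair m r D E k)"
    unfolding staircase_def by (rule card_image)
  also have "\<dots> = (\<Sum>k<r. card (stair m r D E k))"
    using stair_disjoint[OF D(4) E(4)] D(2) E(2)
    by (intro card_UN_disjoint) (auto simp: stair_def intro!: finite_PiE)
  also have "\<dots> = r * c ^ (r - 1)" using D(3) E(3) by (simp add: card_stair)
  finally show ?thesis .
qed

text \<open>If three staircase sequences have ordered pivots and their blocks at the median pivot sum to
  zero, then the pivots coincide. This is the only use of \<open>d + e \<noteq> 0\<close>, namely when the pivots are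
  distinct.\<close>

lemma stair_pivots_eq:
  fixes D E :: "F3 vec set"
  assumes D: "D \<subseteq> carrier_vec m" "0\<^sub>v m \<notin> D" and E: "E \<subseteq> carrier_vec m" "0\<^sub>v m \<notin> E"
    and DE: "\<forall>d\<in>D. \<forall>e\<in>E. d + e \<noteq> 0\<^sub>v m"
    and mem: "f \<in> stair m r D E k" "g \<in> stair m r D E l" "h \<in> stair m r D E q"
    and less: "l < r" and le: "k \<le> l" "l \<le> q"
    and sum: "f l + g l + h l = 0\<^sub>v m"
  shows "k = l \<and> l = q"
proof -
  have gl: "g l = 0\<^sub>v m" using stair_nth(2)[OF mem(2) less] by simp
  have f: "f l = 0\<^sub>v m" if "k = l" using stair_nth(2)[OF mem(1) less] that by simp
  have h: "h l = 0\<^sub>v m" if "q = l" using stair_nth(2)[OF mem(3) less] that by simp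
  have f': "f l \<in> E" if "k < l" using stair_nth(3)[OF mem(1) less] that by simp
  have h': "h l \<in> D" if "l < q" using stair_nth(1)[OF mem(3) less] that by simp
  consider "k = l" "l = q" | "k < l" "l = q" | "k = l" "l < q" | "k < l" "l < q"
    using le by linarith
  then show ?thesis
  proof cases
    case 2
    then have "f l \<in> carrier_vec m" using f' E by auto
    with 2 sum f' h gl E(2) show ?thesis by simp
  next
    case 3
    then have "h l \<in> carrier_vec m" using h' D by auto
    with 3 sum h' f gl D(2) show ?thesis by simp
  next
    case 4
    then have c: "f l \<in> carrier_vec m" "h l \<in> carrier_vec m" using f' h' D E by auto
    with sum gl have "h l + f l = 0\<^sub>v m" by (simp add: comm_add_vec)
    with 4 f' h' DE show ?thesis by blast
  qed simp
qed

lemma vec_add_perms: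
  fixes u v w :: "F3 vec"
  assumes "u \<in> carrier_vec m" "v \<in> carrier_vec m" "w \<in> carrier_vec m"
  shows "u + w + v = u + v + w" "v + u + w = u + v + w" "v + w + u = u + v + w"
    "w + u + v = u + v + w" "w + v + u = u + v + w"
  using assms by (auto intro!: eq_vecI simp: algebra_simps)

lemma cap_set_staircase:
  assumes D: "cap_set m D" "0\<^sub>v m \<notin> D" and E: "cap_set m E" "0\<^sub>v m \<notin> E"
    and DE: "\<forall>d\<in>D. \<forall>e\<in>E. d + e \<noteq> 0\<^sub>v m"
  shows "cap_set (m * r) (staircase m r D E)"
  unfolding cap_set_def
proof (intro conjI ballI impI)
  show "staircase m r D E \<subseteq> carrier_vec (m * r)"
    by (auto simp: staircase_def concat_blocks_def)
  fix x y z assume "x \<in> staircase m r D E" "y \<in> staircase m r D E" "z \<in> staircase m r D E"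
    and sum: "x + y + z = 0\<^sub>v (m * r)"
  then obtain f g h k l q where less: "k < r" "l < r" "q < r"
    and mem: "f \<in> stair m r D E k" "g \<in> stair m r D E l" "h \<in> stair m r D E q"
    and eqs: "x = concat_blocks m r f" "y = concat_blocks m r g" "z = concat_blocks m r h"
    by (auto simp: staircase_def)
  have sub: "D \<subseteq> carrier_vec m" "E \<subseteq> carrier_vec m" using D E by (auto simp: cap_set_def)
  note funs = mem[THEN stair_PiE[OF sub]]
  have block: "f j + g j + h j = 0\<^sub>v m" if "j < r" for j
    using concat_blocks_sum_0[OF funs sum[unfolded eqs] that] .
  have c: "f j \<in> carrier_vec m" "g j \<in> carrier_vec m" "h j \<in> carrier_vec m" if "j < r" for j
    using funs that by auto
  have perm: "f j + h j + g j = 0\<^sub>v m" "g j + f j + h j = 0\<^sub>v m" "g j + h j + f j = 0\<^sub>v m"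
    "h j + f j + g j = 0\<^sub>v m" "h j + g j + f j = 0\<^sub>v m" if "j < r" for j
    using block[OF that] by (simp_all only: vec_add_perms[OF c[OF that]])
  note pivots = stair_pivots_eq[OF sub(1) D(2) sub(2) E(2)]
  \<comment> \<open>The cap condition is symmetric, so the pivots may be taken in increasing order.\<close>
  have piv: "k = l \<and> l = q"
  proof -
    consider "k \<le> l" "l \<le> q" | "k \<le> q" "q \<le> l" | "l \<le> k" "k \<le> q"
      | "l \<le> q" "q \<le> k" | "q \<le> k" "k \<le> l" | "q \<le> l" "l \<le> k" by linarith
    then show ?thesis
    proof cases
      case 1 then show ?thesis using pivots[OF DE mem(1,2,3)] less block by blast
    next
      case 2 then show ?thesis using pivots[OF DE mem(1,3,2)] less perm by blast
    next
      case 3 then show ?thesis using pivots[OF DE mem(2,1,3)] less perm by blast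
    next
      case 4 then show ?thesis using pivots[OF DE mem(2,3,1)] less perm by blast
    next
      case 5 then show ?thesis using pivots[OF DE mem(3,1,2)] less perm by blast
    next
      case 6 then show ?thesis using pivots[OF DE mem(3,2,1)] less perm by blast
    qed
  qed
  have eq: "f j = g j \<and> g j = h j" if j: "j < r" for j
  proof (cases j k rule: linorder_cases)
    case less
    then have "f j \<in> D" "g j \<in> D" "h j \<in> D" using mem[THEN stair_nth(1)] j piv by auto
    then show ?thesis using cap_setD[OF D(1)] block[OF j] by blast
  next
    case equal
    then show ?thesis using mem[THEN stair_nth(2)] j piv by auto
  next
    case greater
    then have "f j \<in> E" "g j \<in> E" "h j \<in> E" using mem[THEN stair_nth(3)] j piv by auto
    then show ?thesis using cap_setD[OF E(1)] block[OF j] by blast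
  qed
  have "f = g" using PiE_ext[OF funs(1,2)] eq by auto
  moreover have "g = h" using PiE_ext[OF funs(2,3)] eq by auto
  ultimately show "x = y" "y = z" by (simp_all add: eqs)
qed

section \<open>The large cap set\<close>

theorem theorem1p1:
  fixes n :: nat and A :: "F3 vec set"
  assumes "n \<ge> 1" and "cap_set n A"
  shows "\<forall>r::nat. r \<ge> 1 \<longrightarrow>
    (\<exists>B. cap_set (2 * n * r) B \<and> card B = r * card A ^ (2 * r - 2))"
proof (intro allI impI)
  fix r :: nat assume "r \<ge> 1"
  obtain t where t: "t \<in> carrier_vec n" "t \<notin> A"
    using cap_set_misses_vector[OF assms] .
  define A' where "A' = (\<lambda>x. x - t) ` A"
  have A': "cap_set n A'" "card A' = card A"
    using cap_set_translate[OF assms(2) t(1)] by (simp_all add: A'_def)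
  have zero: "0\<^sub>v n \<notin> A'"
  proof
    assume "0\<^sub>v n \<in> A'"
    then obtain x where x: "x \<in> A" "x - t = 0\<^sub>v n" by (auto simp: A'_def)
    have "x \<in> carrier_vec n" using x(1) assms(2) by (rule cap_set_carrier[rotated])
    then have "x = (x - t) + t" using t(1) by auto
    with x t show False by simp
  qed
  have sub: "A' \<subseteq> carrier_vec n" using A'(1) by (simp add: cap_set_def)
  let ?D = "product_cap A'" and ?E = "rotated_product_cap A'"
  have D: "cap_set (n + n) ?D" "0\<^sub>v (n + n) \<notin> ?D"
    using cap_set_product[OF A'(1)] zero_notin_product_cap[OF sub zero] .
  have E: "cap_set (n + n) ?E" "0\<^sub>v (n + n) \<notin> ?E"
    using cap_set_rotated_product[OF A'(1)] zero_notin_rotated_product_cap[OF sub zero] .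
  have DE: "?D \<subseteq> carrier_vec (n + n)" "?E \<subseteq> carrier_vec (n + n)"
    using D(1) E(1) by (simp_all add: cap_set_def)
  note fin = DE[THEN finite_subset, OF finite_carrier_vec_F3]
  let ?B = "staircase (n + n) r ?D ?E"
  have "cap_set ((n + n) * r) ?B"
    using D E product_rotated_product_nonzero[OF A'(1) zero] by (intro cap_set_staircase) blast+
  moreover have "card ?B = r * (card A ^ 2) ^ (r - 1)"
    using DE fin D(2) E(2) card_product_cap[OF sub] card_rotated_product_cap[OF sub] A'(2)
    by (intro card_staircase) simp_all
  moreover have "(card A ^ 2) ^ (r - 1) = card A ^ (2 * r - 2)"
    by (simp add: diff_mult_distrib2 flip: power_mult)
  ultimately show "\<exists>B. cap_set (2 * n * r) B \<and> card B = r * card A ^ (2 * r - 2)"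
    by (metis mult_2)
qed

end
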